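(* For every $s\in\mathbb C$ and all $n\ge 1$, the function $$f_s(x)=\dfrac{\sin x+1}{\cos^2x}+s\,\sin x$$ satisfies $$\ddot H_n(f_s)=\Bigl(1-s\tbinom n2\Bigr)\prod_{k=1}^{n-1}(k!)^2\,(2k+1)!!.$$ In particular, for $s=-1$, where $f_{-1}(x)=(\sin^3x+1)/\cos^2x$, $$\ddot H_n(f_{-1})=\Bigl(\binom n2+1\Bigr)\prod_{k=1}^{n-1}(k!)^2\,(2k+1)!!.$$
   Context: For a power series $f(x)=\sum_{k\ge0}a_kx^k/k!$, the dilated Hankel determinant is $\ddot H_n(f)=\det(a_{2i+j})_{0\le i,j\le n-1}$. $(2k+1)!!=1\cdot3\cdot5\cdots(2k+1)$; empty products equal $1$. *)

theory Defs
  imports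
    "HOL-Analysis.FPS_Convergence"
    "Jordan_Normal_Form.Determinant"
begin

text \<open>The number \<open>a\<^sub>k\<close> in \<open>f(x) = \<Sum>k. a\<^sub>k x\<^sup>k / k!\<close>.\<close>

definition egf_coeff :: "'a::field_char_0 fps \<Rightarrow> nat \<Rightarrow> 'a" where
  "egf_coeff f k = fact k * fps_nth f k"

lemma fps_eq_egf: "f = Abs_fps (\<lambda>k. egf_coeff f k / fact k)"
  by (rule fps_ext) (simp add: egf_coeff_def)

definition dilated_hankel_det :: "nat \<Rightarrow> 'a::field_char_0 fps \<Rightarrow> 'a" where
  "dilated_hankel_det n f = det (mat n n (\<lambda>(i, j). egf_coeff f (2 * i + j)))"

text \<open>\<open>odd_double_fact k\<close> is \<open>(2k+1)!! = 1 \<cdot> 3 \<cdot> 5 \<cdot> \<dots> \<cdot> (2k+1)\<close>.\<close>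

definition odd_double_fact :: "nat \<Rightarrow> nat" where
  "odd_double_fact k = (\<Prod>i=0..k. 2 * i + 1)"

text \<open>The quotient is one of formal power series; its denominator has constant term \<open>1\<close>.\<close>

definition f_series :: "complex \<Rightarrow> complex fps" where
  "f_series s = (fps_sin 1 + 1) / (fps_cos 1)^2 + fps_const s * fps_sin 1"

text \<open>The formal series is the Taylor expansion at \<open>0\<close> of the corresponding function.\<close>

lemma f_series_expansion:
  "(\<lambda>x. (sin x + 1) / (cos x)^2 + s * sin x) has_fps_expansion f_series s"
  unfolding f_series_def power2_eq_square
  by (intro fps_expansion_intros has_fps_expansion_sin has_fps_expansion_cos) auto

end

theory Submission
  imports Defs
begin

text \<open>
  With \<open>y = 1 / (1 - sin x)\<close> one has \<open>f\<^sub>s = y + s sin x\<close>. Since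
  \<open>(D\<^sup>2 + m\<^sup>2) y\<^sup>m = m (2m+1) y\<^sup>m\<^sup>+\<^sup>1\<close> and \<open>(D\<^sup>2 + 1) sin x = 0\<close>, unitriangular row operations turn the
  rows \<open>D\<^sup>2\<^sup>i f\<^sub>s\<close> into \<open>y + s sin x, c\<^sub>1 y\<^sup>2, c\<^sub>2 y\<^sup>3, \<dots>\<close> with \<open>c\<^sub>k = k! (2k+1)!!\<close>. Modulo \<open>x\<^sup>n\<close>, \<open>sin x\<close> is
  a combination of \<open>y, \<dots>, y\<^sup>n\<close> in which \<open>y\<close> has coefficient \<open>- (n choose 2)\<close>, so the determinant is
  \<open>(1 - s (n choose 2)) c\<^sub>1 \<cdots> c\<^sub>n\<^sub>-\<^sub>1\<close> times that of the Taylor coefficients of \<open>y, \<dots>, y\<^sup>n\<close>. Expanding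
  in the powers of \<open>y - 1 = x + \<dots>\<close> makes the latter triangular.
\<close>

section \<open>Determinants of Taylor coefficients\<close>

definition egf_mat :: "nat \<Rightarrow> (nat \<Rightarrow> 'a::field_char_0 fps) \<Rightarrow> 'a mat" where
  "egf_mat n F = mat n n (\<lambda>(i, j). egf_coeff (F i) j)"

lemma egf_mat_carrier [simp]: "egf_mat n F \<in> carrier_mat n n"
  by (simp add: egf_mat_def)

lemma egf_coeff_sum: "egf_coeff (\<Sum>k\<in>A. f k) j = (\<Sum>k\<in>A. egf_coeff (f k) j)"
  by (simp add: egf_coeff_def fps_sum_nth sum_distrib_left)

lemma egf_coeff_const_mult: "egf_coeff (fps_const c * f) j = c * egf_coeff f j"
  by (simp add: egf_coeff_def)

text \<open>The matrix sees only coefficients below \<open>n\<close>, so a row relation modulo x^n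
  suffices to write it as a product.\<close>

lemma det_egf_mat_comb:
  assumes "\<And>i j. i < n \<Longrightarrow> j < n \<Longrightarrow>
    fps_nth (F i) j = fps_nth (\<Sum>k<n. fps_const (T i k) * G k) j"
  shows "det (egf_mat n F) = det (mat n n (\<lambda>(i, k). T i k)) * det (egf_mat n G)"
proof -
  have "egf_mat n F = mat n n (\<lambda>(i, k). T i k) * egf_mat n G"
  proof (rule eq_matI)
    fix i j
    assume "i < dim_row (mat n n (\<lambda>(i, k). T i k) * egf_mat n G)"
      and "j < dim_col (mat n n (\<lambda>(i, k). T i k) * egf_mat n G)"
    then have ij: "i < n" "j < n"
      by (auto simp: egf_mat_def)
    have "egf_coeff (F i) j = egf_coeff (\<Sum>k<n. fps_const (T i k) * G k) j"
      using assms[OF ij] by (simp add: egf_coeff_def)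
    also have "\<dots> = (\<Sum>k<n. T i k * egf_coeff (G k) j)"
      by (simp add: egf_coeff_sum egf_coeff_const_mult)
    finally show "egf_mat n F $$ (i, j) = (mat n n (\<lambda>(i, k). T i k) * egf_mat n G) $$ (i, j)"
      using ij by (simp add: egf_mat_def scalar_prod_def atLeast0LessThan)
  qed (auto simp: egf_mat_def)
  then show ?thesis
    by (simp add: det_mult[of _ n])
qed

lemma prod_list_diag_mat:
  "prod_list (diag_mat (mat n n f)) = (\<Prod>i<n. f (i, i))"
  by (simp add: diag_mat_def prod.list_conv_set_nth atLeast0LessThan)

lemma det_mat_lower:
  fixes T :: "nat \<Rightarrow> nat \<Rightarrow> 'a::idom"
  assumes "\<And>i j. i < j \<Longrightarrow> T i j = 0"
  shows "det (mat n n (\<lambda>(i, j). T i j)) = (\<Prod>i<n. T i i)"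
  by (subst det_lower_triangular[of n]) (auto simp: assms prod_list_diag_mat)

lemma det_mat_upper:
  fixes T :: "nat \<Rightarrow> nat \<Rightarrow> 'a::idom"
  assumes "\<And>i j. j < i \<Longrightarrow> T i j = 0"
  shows "det (mat n n (\<lambda>(i, j). T i j)) = (\<Prod>i<n. T i i)"
  by (subst det_upper_triangular[of _ n]) (auto simp: assms prod_list_diag_mat)

text \<open>\<open>w ^ l\<close> has order at least \<open>l\<close>, so the matrix is upper
  triangular and only the constant term of \<open>g\<close> enters its diagonal.\<close>

lemma det_egf_mat_mult_power:
  fixes w g :: "'a::field_char_0 fps"
  assumes "fps_nth w 0 = 0"
  shows "det (egf_mat n (\<lambda>l. g * w ^ l)) = (\<Prod>l<n. fact l * (fps_nth g 0 * fps_nth w 1 ^ l))"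
proof -
  have low: "fps_nth (w ^ l) j = 0" if "j < l" for j l
    using startsby_zero_power_prefix[OF assms] that by auto
  have "fps_nth (g * w ^ l) j = 0" if "j < l" for j l
    using that by (auto simp: fps_mult_nth low)
  moreover have "fps_nth (g * w ^ l) l = fps_nth g 0 * fps_nth w 1 ^ l" for l
  proof -
    have "fps_nth (g * w ^ l) l = (\<Sum>i\<in>{0}. fps_nth g i * fps_nth (w ^ l) (l - i))"
      unfolding fps_mult_nth by (rule sum.mono_neutral_right) (auto simp: low)
    then show ?thesis
      by (simp add: startsby_zero_power_nth_same[OF assms])
  qed
  ultimately show ?thesis
    unfolding egf_mat_def by (subst det_mat_upper) (auto simp: egf_coeff_def)
qed

text \<open>Expanding (1 + (y - 1))^i binomially reduces to the rows \<open>y * (y - 1) ^ k\<close>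
  by a unitriangular matrix, and \<open>y - 1\<close> has no constant term.\<close>

lemma det_egf_mat_powers:
  fixes y :: "'a::field_char_0 fps"
  assumes "fps_nth y 0 = 1"
  shows "det (egf_mat n (\<lambda>m. y ^ Suc m)) = (\<Prod>m<n. fact m * fps_nth y 1 ^ m)"
proof -
  have "y ^ Suc i = (\<Sum>k<n. fps_const (of_nat (i choose k)) * (y * (y - 1) ^ k))"
    if "i < n" for i
  proof -
    have "y ^ Suc i = y * (\<Sum>k\<le>i. of_nat (i choose k) * (y - 1) ^ k)"
      using binomial_ring[of "y - 1" 1 i] by simp
    also have "\<dots> = (\<Sum>k\<le>i. fps_const (of_nat (i choose k)) * (y * (y - 1) ^ k))"
      by (simp add: sum_distrib_left mult_ac fps_of_nat)
    also have "\<dots> = (\<Sum>k<n. fps_const (of_nat (i choose k)) * (y * (y - 1) ^ k))"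
      by (rule sum.mono_neutral_left) (use that in auto)
    finally show ?thesis .
  qed
  then have "det (egf_mat n (\<lambda>m. y ^ Suc m)) =
    det (mat n n (\<lambda>(i, k). of_nat (i choose k))) * det (egf_mat n (\<lambda>k. y * (y - 1) ^ k))"
    by (intro det_egf_mat_comb) simp
  also have "det (mat n n (\<lambda>(i, k). of_nat (i choose k) :: 'a)) = 1"
    by (subst det_mat_lower) auto
  finally show ?thesis
    using assms by (simp add: det_egf_mat_mult_power)
qed

section \<open>Row operations by the second derivative\<close>

abbreviation fps_deriv2 :: "'a::comm_semiring_1 fps \<Rightarrow> 'a fps" where
  "fps_deriv2 f \<equiv> fps_deriv (fps_deriv f)"

text \<open>Each derivative shifts the coefficients by one, so row \<open>i\<close> of the dilated
  Hankel matrix belongs to D^(2i) f.\<close>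

lemma egf_coeff_deriv2_funpow:
  "egf_coeff ((fps_deriv2 ^^ i) f) j = egf_coeff f (2 * i + j)"
proof (induction i arbitrary: j)
  case (Suc i)
  have "egf_coeff (fps_deriv g) k = egf_coeff g (Suc k)" for g :: "'a fps" and k
    by (simp add: egf_coeff_def)
  then show ?case
    by (simp add: Suc.IH)
qed simp

lemma dilated_hankel_det_eq:
  "dilated_hankel_det n f = det (egf_mat n (\<lambda>i. (fps_deriv2 ^^ i) f))"
  by (simp add: dilated_hankel_det_def egf_mat_def egf_coeff_deriv2_funpow)

text \<open>The coordinates of D^(2i) R_0 along R_0, R_1, ... when D^2 R_k = R_(k+1) + b_k
  R_k.\<close>

primrec rec_coeff :: "(nat \<Rightarrow> 'a::comm_ring_1) \<Rightarrow> nat \<Rightarrow> nat \<Rightarrow> 'a" where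
  "rec_coeff b 0 = (\<lambda>k. if k = 0 then 1 else 0)"
| "rec_coeff b (Suc i) = (\<lambda>k. (if k = 0 then 0 else rec_coeff b i (k - 1)) + b k * rec_coeff b i k)"

lemma rec_coeff_eq_0: "i < k \<Longrightarrow> rec_coeff b i k = 0"
  by (induction i arbitrary: k) auto

lemma rec_coeff_diag: "rec_coeff b i i = 1"
  by (induction i) (auto simp: rec_coeff_eq_0)

lemma deriv2_funpow_eq_sum:
  fixes R :: "nat \<Rightarrow> 'a::comm_ring_1 fps"
  assumes R: "\<And>k. fps_deriv2 (R k) = R (Suc k) + fps_const (b k) * R k"
    and "i < n"
  shows "(fps_deriv2 ^^ i) (R 0) = (\<Sum>k<n. fps_const (rec_coeff b i k) * R k)"
  using \<open>i < n\<close>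
proof (induction i arbitrary: n)
  case 0
  have "(\<Sum>k<n. fps_const (rec_coeff b 0 k) * R k) = (\<Sum>k\<in>{0}. fps_const (rec_coeff b 0 k) * R k)"
    by (rule sum.mono_neutral_right) (use 0 in auto)
  then show ?case
    by simp
next
  case (Suc i)
  \<comment> \<open>The induction hypothesis is taken at n - 1, since D^2 raises the index of
    \<open>R\<close> by one.\<close>
  then obtain n' where n: "n = Suc n'" "i < n'"
    by (cases n) auto
  let ?c = "\<lambda>k. fps_const (rec_coeff b i k)"
  have "(fps_deriv2 ^^ Suc i) (R 0) = fps_deriv2 (\<Sum>k<n'. ?c k * R k)"
    using Suc.IH[OF n(2)] by simp
  also have "\<dots> = (\<Sum>k<n'. ?c k * R (Suc k)) + (\<Sum>k<n'. fps_const (b k) * ?c k * R k)"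
    by (simp add: fps_deriv_sum R sum.distrib algebra_simps del: fps_const_mult)
  \<comment> \<open>The added term at \<open>n'\<close> vanishes because
    \<open>i < n'\<close>.\<close>
  also have "(\<Sum>k<n'. fps_const (b k) * ?c k * R k) = (\<Sum>k<n. fps_const (b k) * ?c k * R k)"
    using n by (simp add: rec_coeff_eq_0)
  also have "(\<Sum>k<n'. ?c k * R (Suc k)) =
      (\<Sum>k<n. fps_const (if k = 0 then 0 else rec_coeff b i (k - 1)) * R k)"
    unfolding n(1) sum.lessThan_Suc_shift by simp
  finally show ?case
    by (simp add: sum.distrib[symmetric] algebra_simps flip: fps_const_add)
qed

text \<open>The coordinate matrix is lower unitriangular, so passing from D^(2i) R_0 to R_i keeps
  the determinant.\<close>

lemma dilated_hankel_det_rec: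
  fixes R :: "nat \<Rightarrow> 'a::field_char_0 fps"
  assumes "\<And>k. fps_deriv2 (R k) = R (Suc k) + fps_const (b k) * R k"
  shows "dilated_hankel_det n (R 0) = det (egf_mat n R)"
proof -
  have "dilated_hankel_det n (R 0) =
    det (mat n n (\<lambda>(i, k). rec_coeff b i k)) * det (egf_mat n R)"
    unfolding dilated_hankel_det_eq
    by (rule det_egf_mat_comb) (simp add: deriv2_funpow_eq_sum[of R b, OF assms])
  then show ?thesis
    by (subst (asm) det_mat_lower) (simp_all add: rec_coeff_eq_0 rec_coeff_diag)
qed

section \<open>The series \<open>1 / (1 - sin x)\<close>\<close>

text \<open>This is (1 + sin x) / cos^2 x with the factor 1 + sin x cancelled.\<close>

definition inv_one_minus_sin :: "'a::field_char_0 fps" where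
  "inv_one_minus_sin = inverse (1 - fps_sin 1)"

context
  fixes y S C :: "'a::field_char_0 fps"
  defines "y \<equiv> inv_one_minus_sin" and "S \<equiv> fps_sin 1" and "C \<equiv> fps_cos 1"
begin

section \<open>Algebraic relations and derivatives of y\<close>

lemma inv_one_minus_sin_mult: "y * (1 - S) = 1"
  unfolding y_def S_def inv_one_minus_sin_def by (rule inverse_mult_eq_1) simp

lemma inv_one_minus_sin_mult_sin: "y * S = y - 1"
  using inv_one_minus_sin_mult by (simp add: algebra_simps)

lemma fps_cos_squared: "C * C = 1 - S * S"
  using fps_sin_cos_sum_of_squares[of "1::'a"]
  by (simp add: C_def S_def power2_eq_square algebra_simps eq_diff_eq)

text \<open>Since cos^2 = (1 - S)(1 + S), one factor y cancels 1 - S. This removes the cosine from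
  second derivatives.\<close>

lemma inv_one_minus_sin_sq_cos_sq: "y * y * C * C = 2 * y - 1"
proof -
  have "y * y * C * C = (y * (1 - S)) * (y + y * S)"
    using fps_cos_squared by (simp add: mult.assoc) (simp add: algebra_simps)
  then show ?thesis
    by (simp add: inv_one_minus_sin_mult inv_one_minus_sin_mult_sin)
qed

lemma fps_cos_nonzero: "C \<noteq> 0"
  by (rule fps_nonzeroI[of _ 0]) (simp add: C_def)

lemma fps_deriv_sin: "fps_deriv S = C" and fps_deriv_cos: "fps_deriv C = - S"
  by (simp_all add: S_def C_def fps_sin_deriv fps_cos_deriv flip: fps_const_neg)

lemma deriv_inv_one_minus_sin: "fps_deriv y = y * y * C"
proof -
  have "fps_deriv (y * (1 - S)) = 0"
    by (simp add: inv_one_minus_sin_mult)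
  then have "fps_deriv y * (1 - S) = y * C"
    by (simp add: fps_deriv_sin)
  then have "y * (1 - S) * fps_deriv y = y * y * C"
    by (simp add: mult_ac)
  then show ?thesis
    by (simp add: inv_one_minus_sin_mult)
qed

lemma deriv_inv_one_minus_sin_power: "fps_deriv (y ^ m) = of_nat m * y ^ Suc m * C"
  by (induction m) (simp_all add: deriv_inv_one_minus_sin algebra_simps)

text \<open>Differentiating m y^(m+1) C produces y^2 C^2 and y S, which become 2y - 1 and y -
  1.\<close>

lemma deriv2_inv_one_minus_sin_power:
  "fps_deriv2 (y ^ m) = of_nat (m * (2 * m + 1)) * y ^ Suc m - of_nat (m\<^sup>2) * y ^ m"
proof -
  have "fps_deriv2 (y ^ m) =
    of_nat m * (of_nat (Suc m) * y ^ m * (y * y * C * C) - y ^ m * (y * S))"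
    by (simp add: deriv_inv_one_minus_sin_power deriv_inv_one_minus_sin fps_deriv_cos algebra_simps)
  then show ?thesis
    by (simp only: inv_one_minus_sin_sq_cos_sq inv_one_minus_sin_mult_sin) (simp add: algebra_simps power2_eq_square)
qed

section \<open>The sine modulo x^n in powers of y\<close>

text \<open>The sum on the left is the truncation of \<open>w / (1+w)\<^sup>2 = sin x / y\<close> with \<open>w = y - 1\<close>.\<close>

lemma sin_eq_sum:
  "y * (\<Sum>k<n. (-1) ^ Suc k * of_nat k * (y - 1) ^ k) =
    S + (-1) ^ n * (1 - S) * (of_nat n + (of_nat n - 1) * (y - 1)) * (y - 1) ^ n"
proof -
  define P where "P = (\<Sum>k<n. (-1) ^ Suc k * of_nat k * (y - 1) ^ k)"
  \<comment> \<open>With y = 1 + w, multiplying by (1 + w)^2 collapses the sum to w plus boundary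
    terms of order at least n in w.\<close>
  have "P * y\<^sup>2 = (y - 1) + (-1) ^ n * (of_nat n + (of_nat n - 1) * (y - 1)) * (y - 1) ^ n"
    unfolding P_def
    by (induction n) (simp_all add: algebra_simps power2_eq_square)
  \<comment> \<open>As 1 - S is the inverse of y, this factor turns P y^2 into y P and y - 1 into
    S.\<close>
  then have "(1 - S) * (P * y\<^sup>2) =
    (1 - S) * ((y - 1) + (-1) ^ n * (of_nat n + (of_nat n - 1) * (y - 1)) * (y - 1) ^ n)"
    by simp
  moreover have "(1 - S) * (P * y\<^sup>2) = y * (1 - S) * (y * P)"
    by (simp add: power2_eq_square mult_ac)
  moreover have "(1 - S) * (y - 1) = S"
    using inv_one_minus_sin_mult by (simp add: algebra_simps)
  ultimately show ?thesis
    by (simp add: inv_one_minus_sin_mult P_def distrib_left mult_ac)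
qed

lemma inv_one_minus_sin_nth_0: "fps_nth y 0 = 1"
  by (simp add: y_def inv_one_minus_sin_def)

lemma inv_one_minus_sin_nth_1: "fps_nth y 1 = 1"
  using fps_deriv_nth[of y 0] inv_one_minus_sin_nth_0 by (simp add: deriv_inv_one_minus_sin C_def)

text \<open>The coefficient of \<open>y ^ Suc m\<close> once each (y - 1)^k in the truncated sum is
  expanded binomially; it depends on \<open>n\<close> through the truncation.\<close>

definition sin_coeff_inv :: "nat \<Rightarrow> nat \<Rightarrow> 'a" where
  "sin_coeff_inv n m = (\<Sum>k<n. (-1) ^ Suc k * of_nat k * (of_nat (k choose m) * (-1) ^ (k - m)))"

text \<open>For m = 0 the two signs multiply to -1, leaving -(0 + 1 + ... + (n - 1)).\<close>

lemma sin_coeff_inv_0: "sin_coeff_inv n 0 = - of_nat (n choose 2)"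
proof -
  have neg: "(-1) ^ Suc k * of_nat k * (of_nat (k choose 0) * (-1) ^ (k - 0)) = - (of_nat k :: 'a)" for k
  proof -
    have "(-1) ^ k * (-1) ^ k = (1 :: 'a)"
      by (simp flip: power_mult_distrib)
    then show ?thesis
      by (simp add: mult.left_commute)
  qed
  then have "sin_coeff_inv n 0 = - of_nat (\<Sum>k<n. k)"
    unfolding sin_coeff_inv_def neg by (simp add: sum_negf)
  also have "(\<Sum>k<n. k) = n choose 2"
    by (simp add: Sum_Ico_nat choose_two flip: atLeast0LessThan)
  finally show ?thesis .
qed

lemma sin_nth_eq:
  assumes "j < n"
  shows "fps_nth S j = fps_nth (\<Sum>m<n. fps_const (sin_coeff_inv n m) * y ^ Suc m) j"
proof -
  have exp: "(y - 1) ^ k = (\<Sum>m<n. of_nat (k choose m) * (-1) ^ (k - m) * y ^ m)" if "k < n" for k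
  proof -
    have "(y - 1) ^ k = (\<Sum>m\<le>k. of_nat (k choose m) * (-1) ^ (k - m) * y ^ m)"
      using binomial_ring[of y "-1" k] by (simp add: mult_ac)
    also have "\<dots> = (\<Sum>m<n. of_nat (k choose m) * (-1) ^ (k - m) * y ^ m)"
      by (rule sum.mono_neutral_left) (use that in auto)
    finally show ?thesis .
  qed
  have const: "fps_const (sin_coeff_inv n m) =
    (\<Sum>k<n. (-1) ^ Suc k * of_nat k * (of_nat (k choose m) * (-1) ^ (k - m)))" for m
  proof -
    have "fps_const (\<Sum>k<n. g k) = (\<Sum>k<n. fps_const (g k))" for g :: "nat \<Rightarrow> 'a"
      by (induction n) (simp_all flip: fps_const_add)
    moreover have "fps_const ((-1) ^ k) = (-1 :: 'a fps) ^ k" for k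
      by (simp flip: fps_const_power fps_const_neg)
    ultimately show ?thesis
      by (simp only: sin_coeff_inv_def fps_of_nat flip: fps_const_mult)
  qed
  have "y * (\<Sum>k<n. (-1) ^ Suc k * of_nat k * (y - 1) ^ k) =
    y * (\<Sum>k<n. \<Sum>m<n. (-1) ^ Suc k * of_nat k * (of_nat (k choose m) * (-1) ^ (k - m) * y ^ m))"
    by (simp add: exp sum_distrib_left)
  also have "\<dots> = (\<Sum>m<n. fps_const (sin_coeff_inv n m) * y ^ Suc m)"
    unfolding const
    by (subst sum.swap) (simp add: sum_distrib_left sum_distrib_right mult_ac)
  finally have "(\<Sum>m<n. fps_const (sin_coeff_inv n m) * y ^ Suc m) =
    S + (-1) ^ n * (1 - S) * (of_nat n + (of_nat n - 1) * (y - 1)) * (y - 1) ^ n"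
    by (simp only: sin_eq_sum[symmetric])
  \<comment> \<open>The error term is a multiple of (y - 1)^n, hence of x^n.\<close>
  moreover have "fps_nth (g * (y - 1) ^ n) j = 0" for g
    using startsby_zero_power_prefix[of "y - 1" n] assms
    by (auto simp: fps_mult_nth inv_one_minus_sin_nth_0)
  ultimately show ?thesis
    by (simp del: power_Suc)
qed

section \<open>Evaluation of the determinant\<close>

lemma dilated_hankel_det_inv_one_minus_sin:
  assumes "n \<ge> 1"
  shows "dilated_hankel_det n (y + fps_const s * S) =
    (1 - s * of_nat (n choose 2)) * (\<Prod>k=1..n - 1. (fact k)\<^sup>2 * of_nat (odd_double_fact k))"
proof -
  \<comment> \<open>The product of the factors m(2m+1) for m = 1, ..., k; this scaling gives R_(k+1)
    coefficient 1 in the recurrence.\<close>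
  define c :: "nat \<Rightarrow> nat" where "c k = fact k * odd_double_fact k" for k
  define R where "R k = fps_const (of_nat (c k)) * y ^ Suc k + (if k = 0 then fps_const s * S else 0)" for k
  \<comment> \<open>The coordinates of R_i along y, ..., y^n modulo x^n: only row 0 is not diagonal,
    so the sine affects the determinant through \<open>U 0 0\<close> alone.\<close>
  define U where "U i m = (if i = 0 then (if m = 0 then 1 else 0) + s * sin_coeff_inv n m
      else if m = i then of_nat (c i) else 0)" for i m
  have c0: "c 0 = 1" and cSuc: "c (Suc k) = c k * (Suc k * (2 * Suc k + 1))" for k
    by (simp_all add: c_def odd_double_fact_def) (simp add: algebra_simps)
  have "fps_deriv2 (R k) = R (Suc k) + fps_const (- of_nat ((Suc k)\<^sup>2)) * R k" for k
  proof -
    have const: "fps_const (of_nat (c (Suc k)) :: 'a) =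
        fps_const (of_nat (c k)) * of_nat (Suc k * (2 * Suc k + 1))"
      "fps_const (- of_nat ((Suc k)\<^sup>2) :: 'a) = - of_nat ((Suc k)\<^sup>2)"
      by (simp_all only: cSuc of_nat_mult fps_of_nat flip: fps_const_mult fps_const_neg)
    have ring: "a * (b * p - d * q) = a * b * p + (- d) * (a * q)" for a b d p q :: "'a fps"
      by (simp add: algebra_simps)
    have "fps_deriv2 (fps_const (of_nat (c k)) * y ^ Suc k) =
        fps_const (of_nat (c k)) * fps_deriv2 (y ^ Suc k)"
      by (simp only: fps_deriv_mult_const_left)
    also have "\<dots> = fps_const (of_nat (c (Suc k))) * y ^ Suc (Suc k) +
        fps_const (- of_nat ((Suc k)\<^sup>2)) * (fps_const (of_nat (c k)) * y ^ Suc k)"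
      unfolding deriv2_inv_one_minus_sin_power const by (rule ring)
    \<comment> \<open>For k = 0, D^2 sin = -sin matches b_0 = -1, so R_1 receives no sine
      term.\<close>
    finally show ?thesis
      unfolding R_def
      by (cases "k = 0") (simp_all add: fps_deriv_sin fps_deriv_cos distrib_left
          del: power_Suc flip: fps_const_neg)
  qed
  then have "dilated_hankel_det n (R 0) = det (egf_mat n R)"
    by (rule dilated_hankel_det_rec)
  also have "\<dots> = det (mat n n (\<lambda>(i, m). U i m)) * det (egf_mat n (\<lambda>m. y ^ Suc m))"
  proof (rule det_egf_mat_comb)
    fix i j assume ij: "i < n" "j < n"
    have delta: "(\<Sum>m<n. fps_const (if m = i then a else 0) * y ^ Suc m) = fps_const a * y ^ Suc i" for a
    proof -
      have "(\<Sum>m<n. fps_const (if m = i then a else 0) * y ^ Suc m) =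
        (\<Sum>m\<in>{i}. fps_const (if m = i then a else 0) * y ^ Suc m)"
        by (rule sum.mono_neutral_right) (use ij in auto)
      then show ?thesis by simp
    qed
    show "fps_nth (R i) j = fps_nth (\<Sum>m<n. fps_const (U i m) * y ^ Suc m) j"
    proof (cases "i = 0")
      case True
      have "(\<Sum>m<n. fps_const (U i m) * y ^ Suc m) =
        (\<Sum>m<n. fps_const (if m = i then 1 else 0) * y ^ Suc m) +
        fps_const s * (\<Sum>m<n. fps_const (sin_coeff_inv n m) * y ^ Suc m)"
        using True by (simp add: U_def sum.distrib sum_distrib_left algebra_simps
          flip: fps_const_add fps_const_mult del: power_Suc)
      also have "\<dots> = y + fps_const s * (\<Sum>m<n. fps_const (sin_coeff_inv n m) * y ^ Suc m)"
        using True delta[of 1] by simp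
      finally show ?thesis
        using True ij sin_nth_eq[of j n] by (simp add: R_def c0 del: power_Suc)
    next
      case False
      then show ?thesis
        using delta by (simp add: R_def U_def del: power_Suc)
    qed
  qed
  also have "det (mat n n (\<lambda>(i, m). U i m)) = (\<Prod>i<n. U i i)"
    by (rule det_mat_upper) (auto simp: U_def)
  also have "det (egf_mat n (\<lambda>m. y ^ Suc m)) = (\<Prod>m<n. fact m)"
    using det_egf_mat_powers[OF inv_one_minus_sin_nth_0] inv_one_minus_sin_nth_1 by simp
  also have "(\<Prod>i<n. U i i) * (\<Prod>m<n. fact m) = (\<Prod>i<n. U i i * fact i)"
    by (simp add: prod.distrib)
  also have "\<dots> = U 0 0 * (\<Prod>i=1..n - 1. U i i * fact i)"
  proof -
    have "{..<n} = insert 0 {1..n - 1}"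
      using assms by auto
    then show ?thesis
      by simp
  qed
  also have "(\<Prod>i=1..n - 1. U i i * fact i) =
      (\<Prod>k=1..n - 1. (fact k)\<^sup>2 * of_nat (odd_double_fact k))"
    by (rule prod.cong) (auto simp: U_def c_def power2_eq_square)
  finally show ?thesis
    by (simp add: R_def U_def c0 sin_coeff_inv_0)
qed

lemma quotient_eq_inv_one_minus_sin: "(S + 1) / C ^ 2 = y"
proof -
  have "S + 1 = y * C ^ 2"
  proof -
    have "y * C ^ 2 = y * (1 - S) * (S + 1)"
      by (simp add: power2_eq_square fps_cos_squared algebra_simps)
    then show ?thesis
      by (simp add: inv_one_minus_sin_mult)
  qed
  moreover have "C ^ 2 \<noteq> 0"
    by (simp add: fps_cos_nonzero)
  ultimately show ?thesis
    by simp
qed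

end

theorem proposition15p1:
  fixes s :: complex and n :: nat
  assumes "n \<ge> 1"
  shows "dilated_hankel_det n (f_series s) =
           (1 - s * of_nat (n choose 2)) *
           (\<Prod>k=1..n - 1. (fact k)^2 * of_nat (odd_double_fact k))
       \<and> f_series (-1) = ((fps_sin 1)^3 + 1) / (fps_cos 1)^2
       \<and> dilated_hankel_det n (f_series (-1)) =
           (of_nat (n choose 2) + 1) *
           (\<Prod>k=1..n - 1. (fact k)^2 * of_nat (odd_double_fact k))"
proof -
  have det: "dilated_hankel_det n (f_series t) =
      (1 - t * of_nat (n choose 2)) *
      (\<Prod>k=1..n - 1. (fact k)^2 * of_nat (odd_double_fact k))" for t
    using dilated_hankel_det_inv_one_minus_sin[OF assms, of t]
    by (simp add: f_series_def quotient_eq_inv_one_minus_sin)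
  moreover have "f_series (-1) = ((fps_sin 1)^3 + 1) / (fps_cos 1)^2"
  proof -
    define S C :: "complex fps" where "S = fps_sin 1" and "C = fps_cos 1"
    have "C ^ 2 = 1 - S ^ 2"
      using fps_cos_squared by (simp add: C_def S_def power2_eq_square)
    \<comment> \<open>Uses sin^3 = sin - sin cos^2, so that the division splits off exactly
      -S.\<close>
    then have "S ^ 3 + 1 = (S + 1) + (- S) * C ^ 2"
      by (simp only:) (simp add: algebra_simps power2_eq_square power3_eq_cube)
    moreover have "C ^ 2 \<noteq> 0"
      by (simp add: C_def fps_cos_nonzero)
    ultimately have "(S ^ 3 + 1) / C ^ 2 = - S + (S + 1) / C ^ 2"
      by (simp only: div_mult_self1 not_False_eq_True)
    then show ?thesis
      by (simp add: f_series_def S_def C_def flip: fps_const_neg)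
  qed
  ultimately show ?thesis
    using det[of s] det[of "-1"] by (simp add: add.commute)
qed

end
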